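(* Let $d=2$ and let $f:\mathbb T\to[0,\infty)$ be a potential. Assume that $f$ is decreasing on $(0,1/2]$ (or just that $f(2/5)<f(1/5)$). Then the $5$-point Fibonacci lattice $$\Phi_5=\left\{(0,0),\left(\tfrac15,\tfrac35\right),\left(\tfrac25,\tfrac15\right),\left(\tfrac35,\tfrac45\right),\left(\tfrac45,\tfrac25\right)\right\}$$ minimizes the energy $E_F$ among all $5$-point permutation sets, i.e. $E_F(X)\ge E_F(\Phi_5)$ for every $5$-point permutation set $X\subset\mathbb T^2$.
   Context: $\mathbb T=\mathbb R/\mathbb Z$ is identified with $[0,1)$. A potential $f$ on $\mathbb T$ is viewed as an even $1$-periodic function on $\mathbb R$, continuous on $(0,1)$. With $F(t_1,t_2)=f(t_1)f(t_2)$, the energy of $X=\{\mathbf x^0,\dots,\mathbf x^{N-1}\}\subset\mathbb T^2$ is $E_F(X)=\sum_{k\ne\ell}f(x_1^k-x_1^\ell)f(x_2^k-x_2^\ell)$, the sum over ordered pairs $k\neq\ell$ in $\{0,\dots,N-1\}$. A permutation set with $N$ points is a set which, up to translation, has the form $\left\{\left(\frac kN,\frac{\sigma(k)}N\right):k=0,\dots,N-1\right\}$ for a permutation $\sigma$ of $\{0,1,\dots,N-1\}$. *)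

theory Defs
  imports Complex_Main "HOL-Library.Product_Plus" "HOL-Combinatorics.Permutations"
begin

text \<open>
  The circle \<open>\<real>/\<int>\<close> is identified with the interval \<open>{0..<1}\<close>, points of the 2-torus with
  pairs of such reals. Functions on the circle are 1-periodic functions on the real line, so
  differences of points need not be reduced modulo 1.
\<close>

definition potential :: "(real \<Rightarrow> real) \<Rightarrow> bool" where
  "potential f \<longleftrightarrow>
     (\<forall>t. f (- t) = f t) \<and> (\<forall>t. f (t + 1) = f t) \<and> continuous_on {0<..<1} f"

definition tensor :: "(real \<Rightarrow> real) \<Rightarrow> real \<times> real \<Rightarrow> real" where
  "tensor f t = f (fst t) * f (snd t)"

definition energy :: "(real \<times> real \<Rightarrow> real) \<Rightarrow> (real \<times> real) set \<Rightarrow> real" where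
  "energy F X = (\<Sum>(x, y) \<in> {(x, y). x \<in> X \<and> y \<in> X \<and> x \<noteq> y}. F (x - y))"

definition torus_translate :: "real \<times> real \<Rightarrow> real \<times> real \<Rightarrow> real \<times> real" where
  "torus_translate v x = (frac (fst x + fst v), frac (snd x + snd v))"

definition permutation_set :: "nat \<Rightarrow> (real \<times> real) set \<Rightarrow> bool" where
  "permutation_set N X \<longleftrightarrow>
     (\<exists>\<sigma> v. \<sigma> permutes {..<N} \<and>
        X = torus_translate v ` {(real k / real N, real (\<sigma> k) / real N) |k. k < N})"

definition fibonacci5 :: "(real \<times> real) set" where
  "fibonacci5 = {(0, 0), (1/5, 3/5), (2/5, 1/5), (3/5, 4/5), (4/5, 2/5)}"

end

theory Submission
  imports Defs "HOL-Library.Periodic_Fun"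
begin

text \<open>
  For \<open>k \<noteq> l\<close> the value \<open>f ((k - l) / 5)\<close> is either \<open>a = f (1/5)\<close> or \<open>b = f (2/5)\<close>, and each of them
  occurs for 10 of the 20 ordered pairs. A permutation \<open>\<sigma>\<close> only rearranges these values, so the
  energy is \<open>\<Sum> u v\<close> with \<open>u, v \<in> {a, b}\<close> and \<open>\<Sum> u = \<Sum> v = 10 (a + b)\<close>. Since
  \<open>(u - (a + b)/2) (v - (a + b)/2) \<ge> - ((a - b)/2)\<^sup>2\<close>, with equality iff \<open>{u, v} = {a, b}\<close>, summing
  gives \<open>\<Sum> u v \<ge> 20 a b\<close>. For the Fibonacci lattice \<open>\<sigma> k = 3 k mod 5\<close> exchanges the differences
  \<open>\<plusminus>1\<close> and \<open>\<plusminus>2\<close>, so equality holds for every pair.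
\<close>

definition off_diag :: "nat \<Rightarrow> (nat \<times> nat) set" where
  "off_diag N = {(k, l). k < N \<and> l < N \<and> k \<noteq> l}"

lemma potential_add_int:
  assumes "potential f"
  shows "f (t + of_int n) = f t"
proof -
  interpret periodic_fun_simple' f
    by standard (use assms in \<open>auto simp: potential_def\<close>)
  show ?thesis by (rule plus_of_int)
qed

text \<open>Reduction modulo 1 changes the difference by an integer, which \<open>f\<close> does not
  see. This removes both \<open>frac\<close> and the translation from the energy.\<close>

lemma potential_frac_diff:
  assumes "potential f"
  shows "f (frac x - frac y) = f (x - y)"
proof -
  have "frac x - frac y = x - y + of_int (\<lfloor>y\<rfloor> - \<lfloor>x\<rfloor>)"
    by (simp add: frac_def)
  then show ?thesis
    using potential_add_int[OF assms] by metis
qed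

text \<open>\<open>energy\<close> sums over a set of points, so distinct indices must give distinct
  points; the first coordinate alone separates them.\<close>

lemma inj_on_frac_translate:
  "inj_on (\<lambda>k. frac (real k / real N + c)) {..<N}"
proof (rule inj_onI)
  fix k l assume kl: "k \<in> {..<N}" "l \<in> {..<N}"
    and eq: "frac (real k / real N + c) = frac (real l / real N + c)"
  define n where "n = \<lfloor>real k / real N + c\<rfloor> - \<lfloor>real l / real N + c\<rfloor>"
  have "real k / real N - real l / real N = of_int n"
    using eq by (simp add: frac_def n_def)
  \<comment> \<open>Membership in \<open>{..<N}\<close> forces N > 0, so the denominator can be
    cleared.\<close>
  then have "real k - real l = of_int n * real N"
    using kl by (simp add: field_simps)
  then have "of_int (int k - int l) = (of_int (n * int N) :: real)"
    by simp
  then have "int k - int l = n * int N"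
    by (simp only: of_int_eq_iff)
  then have "int k mod int N = int l mod int N"
    by (simp add: mod_eq_dvd_iff)
  then show "k = l"
    using kl by simp
qed

lemma energy_permutation:
  assumes f: "potential f"
    and X: "X = torus_translate v ` {(real k / real N, real (\<sigma> k) / real N) |k. k < N}"
  shows "energy (tensor f) X =
    (\<Sum>(k, l)\<in>off_diag N. f ((real k - real l) / N) * f ((real (\<sigma> k) - real (\<sigma> l)) / N))"
proof -
  define p where "p k = torus_translate v (real k / real N, real (\<sigma> k) / real N)" for k
  have X': "X = p ` {..<N}"
    unfolding X p_def by auto
  have inj: "inj_on p {..<N}"
    using inj_on_frac_translate[of N "fst v"]
    by (auto simp: inj_on_def p_def torus_translate_def)
  have pairs: "{(x, y). x \<in> X \<and> y \<in> X \<and> x \<noteq> y} = map_prod p p ` off_diag N"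
  proof (intro equalityI subsetI)
    fix z assume "z \<in> {(x, y). x \<in> X \<and> y \<in> X \<and> x \<noteq> y}"
    then obtain x y where "z = (x, y)" "x \<in> p ` {..<N}" "y \<in> p ` {..<N}" "x \<noteq> y"
      unfolding X' by blast
    then obtain k l where "z = map_prod p p (k, l)" "k < N" "l < N" "p k \<noteq> p l"
      by (metis imageE lessThan_iff map_prod_simp)
    then show "z \<in> map_prod p p ` off_diag N"
      by (intro image_eqI[of _ _ "(k, l)"]) (auto simp: off_diag_def)
  next
    fix z assume "z \<in> map_prod p p ` off_diag N"
    then obtain k l where kl: "z = (p k, p l)" "k < N" "l < N" "k \<noteq> l"
      unfolding off_diag_def by force
    then have "p k \<noteq> p l"
      using inj by (auto dest: inj_onD)
    with kl show "z \<in> {(x, y). x \<in> X \<and> y \<in> X \<and> x \<noteq> y}"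
      unfolding X' by simp
  qed
  have inj2: "inj_on (map_prod p p) (off_diag N)"
    by (rule inj_on_subset[OF map_prod_inj_on[OF inj inj]]) (auto simp: off_diag_def)
  have diff: "tensor f (p k - p l) =
      f ((real k - real l) / N) * f ((real (\<sigma> k) - real (\<sigma> l)) / N)" for k l
    by (simp add: tensor_def p_def torus_translate_def potential_frac_diff[OF f] diff_divide_distrib)
  show ?thesis
    unfolding energy_def pairs by (simp add: sum.reindex[OF inj2] case_prod_unfold diff)
qed

text \<open>A permutation applied to both indices permutes the pairs of distinct indices, since
  injectivity keeps them off the diagonal.\<close>

lemma sum_off_diag_permutes:
  assumes "\<sigma> permutes {..<N}"
  shows "(\<Sum>(k, l)\<in>off_diag N. g (\<sigma> k) (\<sigma> l)) = (\<Sum>(k, l)\<in>off_diag N. g k l)"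
proof -
  note inj = permutes_inj[OF assms]
  have "map_prod \<sigma> \<sigma> ` off_diag N = off_diag N"
  proof (intro equalityI subsetI)
    fix x assume "x \<in> map_prod \<sigma> \<sigma> ` off_diag N"
    then show "x \<in> off_diag N"
      using permutes_in_image[OF assms] inj by (auto simp: off_diag_def inj_def)
  next
    fix x assume x: "x \<in> off_diag N"
    obtain k l where "x = (\<sigma> k, \<sigma> l)"
      using permutes_surj[OF assms] by (metis surj_def surj_pair)
    with x show "x \<in> map_prod \<sigma> \<sigma> ` off_diag N"
      using permutes_in_image[OF assms] by (force simp: off_diag_def)
  qed
  then have "bij_betw (map_prod \<sigma> \<sigma>) (off_diag N) (off_diag N)"
    using inj by (auto simp: bij_betw_def inj_on_def inj_def)
  from sum.reindex_bij_betw[OF this, of "\<lambda>(k, l). g k l"] show ?thesis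
    by (simp add: case_prod_unfold)
qed

lemma lessThan_5: "{..<5} = {0, 1, 2, 3, 4::nat}"
  by auto

lemma off_diag_5:
  "off_diag 5 = {(4,0),(4,1),(4,2),(4,3),(3,0),(3,1),(3,2),(3,4),(2,0),(2,1),
    (2,3),(2,4),(1,0),(1,2),(1,3),(1,4),(0,1),(0,2),(0,3),(0,4)}"
proof -
  have "off_diag 5 = (\<Union>k\<in>{..<5}. Pair k ` ({..<5} - {k}))"
    by (auto simp: off_diag_def)
  then show ?thesis
    by (simp add: lessThan_5 insert_Diff_if)
qed

text \<open>Modulo 1, 3/5 is -2/5 and 4/5 is -1/5; evenness then leaves only two values.\<close>

lemma potential_fifths:
  assumes "potential f"
  shows "f (- (1/5)) = f (1/5)" "f (- (2/5)) = f (2/5)"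
    "f (3/5) = f (2/5)" "f (- (3/5)) = f (2/5)"
    "f (4/5) = f (1/5)" "f (- (4/5)) = f (1/5)"
proof -
  have ev: "f (- t) = f t" and per: "f (t + 1) = f t" for t
    using assms by (auto simp: potential_def)
  show "f (- (1/5)) = f (1/5)" "f (- (2/5)) = f (2/5)" by (rule ev)+
  then show "f (3/5) = f (2/5)" "f (4/5) = f (1/5)"
    using per[of "- (2/5)"] per[of "- (1/5)"] by simp_all
  then show "f (- (3/5)) = f (2/5)" "f (- (4/5)) = f (1/5)"
    using ev by simp_all
qed

lemma energy_permutation_5_ge:
  assumes f: "potential f" and X: "permutation_set 5 X"
  shows "20 * f (1/5) * f (2/5) \<le> energy (tensor f) X"
proof -
  obtain \<sigma> v where \<sigma>: "\<sigma> permutes {..<5}"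
    and Xeq: "X = torus_translate v ` {(real k / real 5, real (\<sigma> k) / real 5) |k. k < 5}"
    using X unfolding permutation_set_def by auto
  define a b where "a = f (1/5)" and "b = f (2/5)"
  define g where "g k l = f ((real k - real l) / 5)" for k l :: nat
  note fifths = potential_fifths[OF f]
  have energy: "energy (tensor f) X = (\<Sum>(k, l)\<in>off_diag 5. g k l * g (\<sigma> k) (\<sigma> l))"
    using energy_permutation[OF f Xeq] by (simp add: g_def)
  have range: "g k l = a \<or> g k l = b" if "(k, l) \<in> off_diag 5" for k l
    using that by (auto simp: off_diag_5 g_def a_def b_def fifths)
  have sum_g: "(\<Sum>(k, l)\<in>off_diag 5. g k l) = 10 * (a + b)"
    by (simp add: off_diag_5 g_def a_def b_def fifths)
  \<comment> \<open>This is the product inequality of the introduction expanded, using ((a + b)/2)^2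
    + ((a - b)/2)^2 = (a^2 + b^2)/2. The left side is affine in the two factors, so its sum depends
    only on their totals.\<close>
  have bound: "(a + b) / 2 * (g k l + g (\<sigma> k) (\<sigma> l)) - (a\<^sup>2 + b\<^sup>2) / 2 \<le> g k l * g (\<sigma> k) (\<sigma> l)"
    if "(k, l) \<in> off_diag 5" for k l
  proof -
    have "(\<sigma> k, \<sigma> l) \<in> off_diag 5"
      using that permutes_in_image[OF \<sigma>] permutes_inj[OF \<sigma>] by (auto simp: off_diag_def inj_def)
    moreover have "(a + b) / 2 * (u + w) - (a\<^sup>2 + b\<^sup>2) / 2 \<le> u * w"
      if "u = a \<or> u = b" "w = a \<or> w = b" for u w
      \<comment> \<open>If u = w, the gap is (a - b)^2 / 2; otherwise both sides equal a b.\<close>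
      using that zero_le_power2[of "a - b"]
      by (auto simp: power2_eq_square field_simps)
    ultimately show ?thesis
      using range that by blast
  qed
  have card: "card (off_diag 5) = 20"
    by (simp add: off_diag_5)
  have "20 * a * b = (a + b) / 2 * (10 * (a + b) + 10 * (a + b)) - 20 * ((a\<^sup>2 + b\<^sup>2) / 2)"
    by (simp add: power2_eq_square field_simps)
  also have "\<dots> = (\<Sum>(k, l)\<in>off_diag 5.
      (a + b) / 2 * (g k l + g (\<sigma> k) (\<sigma> l)) - (a\<^sup>2 + b\<^sup>2) / 2)"
    unfolding case_prod_unfold sum_subtractf sum.distrib sum_distrib_left[symmetric]
    using sum_g sum_off_diag_permutes[OF \<sigma>, of g]
    by (simp add: case_prod_unfold card)
  also have "\<dots> \<le> (\<Sum>(k, l)\<in>off_diag 5. g k l * g (\<sigma> k) (\<sigma> l))"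
    by (rule sum_mono) (use bound in auto)
  finally show ?thesis
    by (simp add: energy a_def b_def)
qed

text \<open>As 3 is -2 modulo 5, differences 1 and 2 go to -2 and 1. Outside \<open>{..<5}\<close>
  it is the identity, as \<open>permutes\<close> requires.\<close>

definition fib_perm :: "nat \<Rightarrow> nat" where
  "fib_perm k = (if k < 5 then 3 * k mod 5 else k)"

lemma fib_perm_permutes: "fib_perm permutes {..<5}"
proof (rule bij_imp_permutes)
  show "bij_betw fib_perm {..<5} {..<5}"
    unfolding bij_betw_def lessThan_5 by (auto simp: inj_on_def fib_perm_def)
qed (simp add: fib_perm_def)

lemma fibonacci5_eq:
  "fibonacci5 = torus_translate 0 ` {(real k / real 5, real (fib_perm k) / real 5) |k. k < 5}"
proof -
  have "{(real k / real 5, real (fib_perm k) / real 5) |k. k < 5} =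
      (\<lambda>k. (real k / real 5, real (fib_perm k) / real 5)) ` {..<5}"
    by auto
  moreover have "frac t = t" if "0 \<le> t" "t < 1" for t :: real
    using that by (simp add: frac_eq)
  ultimately show ?thesis
    by (simp add: lessThan_5 fib_perm_def fibonacci5_def torus_translate_def)
qed

lemma permutation_set_fibonacci5: "permutation_set 5 fibonacci5"
  unfolding permutation_set_def
  by (intro exI conjI) (rule fib_perm_permutes, rule fibonacci5_eq)

lemma energy_fibonacci5:
  assumes f: "potential f"
  shows "energy (tensor f) fibonacci5 = 20 * f (1/5) * f (2/5)"
  unfolding energy_permutation[OF f fibonacci5_eq]
  by (simp add: off_diag_5 fib_perm_def potential_fifths[OF f])

theorem lemma2p6:
  fixes f :: "real \<Rightarrow> real"
  assumes "potential f"
    and "\<And>t. 0 \<le> f t"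
    and "antimono_on {0<..1/2} f \<or> f (2/5) < f (1/5)"
  shows "permutation_set 5 fibonacci5 \<and>
    (\<forall>X. permutation_set 5 X \<longrightarrow> energy (tensor f) fibonacci5 \<le> energy (tensor f) X)"
  using permutation_set_fibonacci5 energy_fibonacci5 energy_permutation_5_ge assms(1) by simp

end
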